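(* Let $R$ be a ring, let $M$ be a left $R$-module with injective hull $E(M)$, and suppose that $M$ and $E(M)$ are both compressible, that $M$ is nonsingular, and that $M$ is stable under partial endomorphisms of $E(M)$. Then $E(M)$ is critically compressible if and only if $M$ is critically compressible.
   Context: Rings are associative with identity $1\neq 0$; modules are unitary left modules. A nonzero module $M$ is compressible if for every nonzero submodule $N\le M$ there is a monomorphism $M\to N$. A module $M$ is critically compressible if it is compressible and, in addition, there is no monomorphism $M\to M/N$ for any nonzero submodule $N\le M$. $M$ is stable under partial endomorphisms of $E(M)$ if $h(M\cap M_1)\subseteq M$ for every submodule $M_1\le E(M)$ and every homomorphism $h:M_1\to E(M)$. $M$ is nonsingular if $Z(M)=0$, where $Z(M)$ is the set of $x\in M$ whose annihilator $\{r\in R: rx=0\}$ is an essential left ideal of $R$. *)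

theory Defs
  imports "HOL-Algebra.Module" "HOL-Algebra.AbelCoset"
begin

text \<open>
  The library locale \<open>module\<close> requires a commutative ring of scalars; here the ring is
  arbitrary.  The module record is reused, its fields \<open>mult\<close> and \<open>one\<close> being irrelevant.
  The library locale \<open>submodule\<close> makes no commutativity assumption.
\<close>

locale left_module = R?: ring R + M?: abelian_group M
  for R :: "('r, 'x) ring_scheme" (structure) and M :: "('r, 'm) module" (structure) +
  assumes smult_closed [simp, intro]:
      "\<lbrakk>a \<in> carrier R; x \<in> carrier M\<rbrakk> \<Longrightarrow> a \<odot>\<^bsub>M\<^esub> x \<in> carrier M"
    and smult_l_distr:
      "\<lbrakk>a \<in> carrier R; b \<in> carrier R; x \<in> carrier M\<rbrakk> \<Longrightarrow>
        (a \<oplus>\<^bsub>R\<^esub> b) \<odot>\<^bsub>M\<^esub> x = a \<odot>\<^bsub>M\<^esub> x \<oplus>\<^bsub>M\<^esub> b \<odot>\<^bsub>M\<^esub> x"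
    and smult_r_distr:
      "\<lbrakk>a \<in> carrier R; x \<in> carrier M; y \<in> carrier M\<rbrakk> \<Longrightarrow>
        a \<odot>\<^bsub>M\<^esub> (x \<oplus>\<^bsub>M\<^esub> y) = a \<odot>\<^bsub>M\<^esub> x \<oplus>\<^bsub>M\<^esub> a \<odot>\<^bsub>M\<^esub> y"
    and smult_assoc1:
      "\<lbrakk>a \<in> carrier R; b \<in> carrier R; x \<in> carrier M\<rbrakk> \<Longrightarrow>
        (a \<otimes>\<^bsub>R\<^esub> b) \<odot>\<^bsub>M\<^esub> x = a \<odot>\<^bsub>M\<^esub> (b \<odot>\<^bsub>M\<^esub> x)"
    and smult_one [simp]:
      "x \<in> carrier M \<Longrightarrow> \<one>\<^bsub>R\<^esub> \<odot>\<^bsub>M\<^esub> x = x"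

text \<open>A submodule \<open>N\<close> of \<open>M\<close>, viewed as a module of its own, is \<open>M\<lparr>carrier := N\<rparr>\<close>.\<close>

definition module_hom ::
  "('r, 'x) ring_scheme \<Rightarrow> ('r, 'a) module \<Rightarrow> ('r, 'b) module \<Rightarrow> ('a \<Rightarrow> 'b) set"
  where "module_hom R A B =
    {f \<in> carrier A \<rightarrow> carrier B.
      (\<forall>x\<in>carrier A. \<forall>y\<in>carrier A. f (x \<oplus>\<^bsub>A\<^esub> y) = f x \<oplus>\<^bsub>B\<^esub> f y) \<and>
      (\<forall>r\<in>carrier R. \<forall>x\<in>carrier A. f (r \<odot>\<^bsub>A\<^esub> x) = r \<odot>\<^bsub>B\<^esub> f x)}"

definition module_mono ::
  "('r, 'x) ring_scheme \<Rightarrow> ('r, 'a) module \<Rightarrow> ('r, 'b) module \<Rightarrow> ('a \<Rightarrow> 'b) set"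
  where "module_mono R A B = {f \<in> module_hom R A B. inj_on f (carrier A)}"

text \<open>
  For a coset \<open>X = N + x\<close> one has \<open>N + r X = N + r x\<close>, so the scalar multiplication below is
  the usual one; adding \<open>N\<close> is needed because \<open>r X\<close> itself may be smaller than a coset.
\<close>

definition quotient_module :: "('r, 'm) module \<Rightarrow> 'm set \<Rightarrow> ('r, 'm set) module"
  where "quotient_module M N =
    \<lparr>carrier = a_rcosets\<^bsub>M\<^esub> N, mult = undefined, one = undefined,
     zero = N, add = (<+>\<^bsub>M\<^esub>),
     smult = (\<lambda>r X. N <+>\<^bsub>M\<^esub> ((\<lambda>x. r \<odot>\<^bsub>M\<^esub> x) ` X))\<rparr>"

definition compressible :: "('r, 'x) ring_scheme \<Rightarrow> ('r, 'm) module \<Rightarrow> bool"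
  where "compressible R M \<longleftrightarrow>
    carrier M \<noteq> {\<zero>\<^bsub>M\<^esub>} \<and>
    (\<forall>N. submodule N R M \<and> N \<noteq> {\<zero>\<^bsub>M\<^esub>} \<longrightarrow>
      (\<exists>f. f \<in> module_mono R M (M\<lparr>carrier := N\<rparr>)))"

definition critically_compressible :: "('r, 'x) ring_scheme \<Rightarrow> ('r, 'm) module \<Rightarrow> bool"
  where "critically_compressible R M \<longleftrightarrow>
    compressible R M \<and>
    (\<forall>N. submodule N R M \<and> N \<noteq> {\<zero>\<^bsub>M\<^esub>} \<longrightarrow>
      \<not> (\<exists>f. f \<in> module_mono R M (quotient_module M N)))"

definition essential_submodule ::
  "('r, 'x) ring_scheme \<Rightarrow> ('r, 'm) module \<Rightarrow> 'm set \<Rightarrow> bool"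
  where "essential_submodule R M N \<longleftrightarrow>
    submodule N R M \<and>
    (\<forall>K. submodule K R M \<and> K \<noteq> {\<zero>\<^bsub>M\<^esub>} \<longrightarrow> N \<inter> K \<noteq> {\<zero>\<^bsub>M\<^esub>})"

text \<open>\<open>R\<close> as a left module over itself; its submodules are the left ideals of \<open>R\<close>.\<close>

definition regular_module :: "('r, 'x) ring_scheme \<Rightarrow> ('r, 'r) module"
  where "regular_module R =
    \<lparr>carrier = carrier R, mult = mult R, one = one R, zero = zero R, add = add R,
     smult = mult R\<rparr>"

definition annihilator :: "('r, 'x) ring_scheme \<Rightarrow> ('r, 'm) module \<Rightarrow> 'm \<Rightarrow> 'r set"
  where "annihilator R M x = {r \<in> carrier R. r \<odot>\<^bsub>M\<^esub> x = \<zero>\<^bsub>M\<^esub>}"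

definition singular_part :: "('r, 'x) ring_scheme \<Rightarrow> ('r, 'm) module \<Rightarrow> 'm set"
  where "singular_part R M =
    {x \<in> carrier M. essential_submodule R (regular_module R) (annihilator R M x)}"

definition nonsingular :: "('r, 'x) ring_scheme \<Rightarrow> ('r, 'm) module \<Rightarrow> bool"
  where "nonsingular R M \<longleftrightarrow> singular_part R M = {\<zero>\<^bsub>M\<^esub>}"

text \<open>
  HOL cannot quantify over modules on all types, so the test modules \<open>A\<close> and \<open>B\<close> range over
  all modules whose elements lie in the type \<open>'r + 'm\<close>.  This loses nothing: the type contains
  copies of \<open>R\<close> and of all its left ideals, so by Baer's criterion a module injective in this
  sense is injective with respect to all modules.  It also contains copies of all submodules
  of \<open>E\<close>.
\<close>

definition injective_module :: "('r, 'x) ring_scheme \<Rightarrow> ('r, 'm) module \<Rightarrow> bool"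
  where "injective_module R E \<longleftrightarrow>
    left_module R E \<and>
    (\<forall>(A :: ('r, 'r + 'm) module) (B :: ('r, 'r + 'm) module).
      left_module R A \<and> left_module R B \<longrightarrow>
      (\<forall>i \<in> module_mono R A B. \<forall>g \<in> module_hom R A E.
        \<exists>h \<in> module_hom R B E. \<forall>a\<in>carrier A. h (i a) = g a))"

text \<open>
  The embedding of \<open>M\<close> into its hull \<open>E\<close> is taken to be an inclusion, so that
  intersections of \<open>M\<close> with submodules of \<open>E\<close> make sense.
\<close>

definition injective_hull ::
  "('r, 'x) ring_scheme \<Rightarrow> ('r, 'm) module \<Rightarrow> ('r, 'm) module \<Rightarrow> bool"
  where "injective_hull R M E \<longleftrightarrow>
    left_module R M \<and> injective_module R E \<and>
    essential_submodule R E (carrier M) \<and>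
    (\<forall>x\<in>carrier M. \<forall>y\<in>carrier M. x \<oplus>\<^bsub>M\<^esub> y = x \<oplus>\<^bsub>E\<^esub> y) \<and>
    (\<forall>r\<in>carrier R. \<forall>x\<in>carrier M. r \<odot>\<^bsub>M\<^esub> x = r \<odot>\<^bsub>E\<^esub> x)"

definition stable_under_partial_endomorphisms ::
  "('r, 'x) ring_scheme \<Rightarrow> ('r, 'm) module \<Rightarrow> ('r, 'm) module \<Rightarrow> bool"
  where "stable_under_partial_endomorphisms R M E \<longleftrightarrow>
    (\<forall>M1. submodule M1 R E \<longrightarrow>
      (\<forall>h \<in> module_hom R (E\<lparr>carrier := M1\<rparr>) E. h ` (carrier M \<inter> M1) \<subseteq> carrier M))"

end

theory Submission
  imports Defs
begin

text \<open>
  Compressibility of \<open>E\<close> gives a monomorphism \<open>f\<close> of \<open>E\<close> into its nonzero submodule \<open>M\<close>.  Its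
  inverse \<open>f(E) \<rightarrow> E\<close> is a partial endomorphism of \<open>E\<close> defined on a submodule of \<open>M\<close>, so stability
  puts its image, which is all of \<open>E\<close>, inside \<open>M\<close>.  Hence \<open>M = E\<close>; the two records can still
  differ in values outside the carrier, on which critical compressibility does not depend.
\<close>

text \<open>Equal carriers do not make two records equal, so agreement is asked only on the carrier.
  Zero and negatives need not be listed, since addition determines them.\<close>

locale agreeing_modules = A: left_module R A + B: left_module R B
  for R :: "('r, 'x) ring_scheme" and A B :: "('r, 'm) module" +
  assumes carrier_eq: "carrier A = carrier B"
    and add_eq: "\<lbrakk>x \<in> carrier A; y \<in> carrier A\<rbrakk> \<Longrightarrow> x \<oplus>\<^bsub>A\<^esub> y = x \<oplus>\<^bsub>B\<^esub> y"
    and smult_eq: "\<lbrakk>r \<in> carrier R; x \<in> carrier A\<rbrakk> \<Longrightarrow> r \<odot>\<^bsub>A\<^esub> x = r \<odot>\<^bsub>B\<^esub> x"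
begin

lemma agreeing_modules_swap: "agreeing_modules R B A"
  by unfold_locales (simp_all add: carrier_eq add_eq smult_eq)

text \<open>The zero of \<open>A\<close> is idempotent for the addition of \<open>B\<close>, and a
  group has only one idempotent.\<close>

lemma zero_eq: "\<zero>\<^bsub>A\<^esub> = \<zero>\<^bsub>B\<^esub>"
  by (metis A.M.l_zero A.M.zero_closed B.M.add.one_unique B.M.add.r_cancel_one add_eq carrier_eq)

lemma a_inv_eq: "x \<in> carrier A \<Longrightarrow> \<ominus>\<^bsub>A\<^esub> x = \<ominus>\<^bsub>B\<^esub> x"
  by (metis A.M.add.inv_closed A.M.l_neg B.M.minus_equality add_eq carrier_eq zero_eq)

lemma submodule_imp: "submodule N R A \<Longrightarrow> submodule N R B"
  \<comment> \<open>Folding \<open>a_inv_def\<close> turns the inverse of the additive monoid back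
    into the module negative, to which \<open>a_inv_eq\<close> applies.\<close>
  unfolding submodule_def submodule_axioms_def subgroup_def a_inv_def[symmetric]
  by (auto simp: carrier_eq[symmetric] add_eq[symmetric] smult_eq[symmetric] zero_eq[symmetric]
      a_inv_eq[symmetric] subset_iff)

lemma submodule_iff: "submodule N R A \<longleftrightarrow> submodule N R B"
  using submodule_imp agreeing_modules.submodule_imp[OF agreeing_modules_swap] by blast

lemma set_add_eq:
  "\<lbrakk>H \<subseteq> carrier A; K \<subseteq> carrier A\<rbrakk> \<Longrightarrow> H <+>\<^bsub>A\<^esub> K = H <+>\<^bsub>B\<^esub> K"
  by (auto simp: set_add_def set_mult_def add_eq subset_iff)

lemma a_rcosets_eq: "N \<subseteq> carrier A \<Longrightarrow> a_rcosets\<^bsub>A\<^esub> N = a_rcosets\<^bsub>B\<^esub> N"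
  by (auto simp: A_RCOSETS_def RCOSETS_def r_coset_def carrier_eq[symmetric] add_eq subset_iff)

lemma module_mono_submodule_eq:
  "N \<subseteq> carrier A \<Longrightarrow>
    module_mono R A (A\<lparr>carrier := N\<rparr>) = module_mono R B (B\<lparr>carrier := N\<rparr>)"
  by (auto simp: module_mono_def module_hom_def carrier_eq[symmetric] add_eq[symmetric]
      smult_eq[symmetric] Pi_iff subset_iff)

text \<open>The quotient records may differ on sets that leave the carrier, but a homomorphism into
  the quotient takes only cosets as values, and these consist of elements on which the operations
  agree.\<close>

lemma module_mono_quotient_eq:
  assumes "N \<subseteq> carrier A"
  shows "module_mono R A (quotient_module A N) = module_mono R B (quotient_module B N)"
proof -
  let ?C = "a_rcosets\<^bsub>A\<^esub> N"
  have sub: "X \<subseteq> carrier A" if "X \<in> ?C" for X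
    using that assms by (auto simp: A_RCOSETS_def RCOSETS_def r_coset_def)
  have add: "X <+>\<^bsub>A\<^esub> Y = X <+>\<^bsub>B\<^esub> Y" if "X \<in> ?C" "Y \<in> ?C" for X Y
    using that sub set_add_eq by blast
  have smult: "N <+>\<^bsub>A\<^esub> ((\<lambda>x. r \<odot>\<^bsub>A\<^esub> x) ` X) = N <+>\<^bsub>B\<^esub> ((\<lambda>x. r \<odot>\<^bsub>B\<^esub> x) ` X)"
    if "r \<in> carrier R" "X \<in> ?C" for r X
  proof -
    have "(\<lambda>x. r \<odot>\<^bsub>A\<^esub> x) ` X = (\<lambda>x. r \<odot>\<^bsub>B\<^esub> x) ` X"
      using sub[OF that(2)] that(1) by (auto simp: smult_eq subset_iff intro!: image_cong)
    moreover have "(\<lambda>x. r \<odot>\<^bsub>A\<^esub> x) ` X \<subseteq> carrier A"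
      using sub[OF that(2)] that(1) by auto
    ultimately show ?thesis
      using set_add_eq[OF assms] by simp
  qed
  show ?thesis
    by (auto simp: module_mono_def module_hom_def quotient_module_def Pi_iff add smult
        carrier_eq[symmetric] a_rcosets_eq[OF assms, symmetric] add_eq[symmetric]
        smult_eq[symmetric])
qed

text \<open>The notion depends on a module only through its zero, its submodules and two sets of
  monomorphisms, each already transferred.\<close>

lemma critically_compressible_iff:
  "critically_compressible R A \<longleftrightarrow> critically_compressible R B"
proof -
  \<comment> \<open>Stated with \<open>B\<close> because \<open>submodule_iff\<close> rewrites
    towards \<open>B\<close> before the side condition on \<open>N\<close> arises.\<close>
  have "N \<subseteq> carrier A" if "submodule N R B" for N
    using that by (simp add: carrier_eq submodule_def subgroup_def)
  then show ?thesis
    by (simp add: critically_compressible_def compressible_def submodule_iff carrier_eq[symmetric]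
        zero_eq module_mono_submodule_eq module_mono_quotient_eq)
qed

end

lemma submodule_image:
  assumes A: "left_module R A" and B: "left_module R B" and f: "f \<in> module_hom R A B"
  shows "submodule (f ` carrier A) R B"
proof -
  interpret A: left_module R A by fact
  interpret B: left_module R B by fact
  have closed: "f x \<in> carrier B" if "x \<in> carrier A" for x
    using f that by (auto simp: module_hom_def)
  have add: "f (x \<oplus>\<^bsub>A\<^esub> y) = f x \<oplus>\<^bsub>B\<^esub> f y" if "x \<in> carrier A" "y \<in> carrier A" for x y
    using f that by (auto simp: module_hom_def)
  have smult: "f (r \<odot>\<^bsub>A\<^esub> x) = r \<odot>\<^bsub>B\<^esub> f x" if "r \<in> carrier R" "x \<in> carrier A" for r x
    using f that by (auto simp: module_hom_def)
  \<comment> \<open>Preservation of zero is not built into \<open>module_hom\<close>; it follows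
    because the image of zero is idempotent under addition.\<close>
  have zero: "f \<zero>\<^bsub>A\<^esub> = \<zero>\<^bsub>B\<^esub>"
    by (metis A.M.l_zero A.M.zero_closed B.M.add.r_cancel_one add closed)
  have inv: "\<ominus>\<^bsub>B\<^esub> f x = f (\<ominus>\<^bsub>A\<^esub> x)" if "x \<in> carrier A" for x
    by (metis A.M.a_inv_closed A.M.l_neg B.M.minus_equality add closed that zero)
  show ?thesis
    unfolding submodule_def submodule_axioms_def subgroup_def a_inv_def[symmetric]
    by (auto simp: closed add[symmetric] smult[symmetric] zero[symmetric] inv)
qed

text \<open>Every point of the domain is some \<open>f x\<close>, which injectivity sends back to
  \<open>x\<close>, so the laws for \<open>f\<close> can be read backwards. With \<open>E\<close>
  for both modules this is a partial endomorphism of \<open>E\<close>.\<close>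

lemma inv_into_module_hom:
  assumes A: "left_module R A" and f: "f \<in> module_mono R A B"
  shows "inv_into (carrier A) f \<in> module_hom R (B\<lparr>carrier := f ` carrier A\<rparr>) A"
proof -
  interpret A: left_module R A by fact
  have inj: "inj_on f (carrier A)"
    and add: "\<And>x y. \<lbrakk>x \<in> carrier A; y \<in> carrier A\<rbrakk> \<Longrightarrow> f x \<oplus>\<^bsub>B\<^esub> f y = f (x \<oplus>\<^bsub>A\<^esub> y)"
    and smult: "\<And>r x. \<lbrakk>r \<in> carrier R; x \<in> carrier A\<rbrakk> \<Longrightarrow> r \<odot>\<^bsub>B\<^esub> f x = f (r \<odot>\<^bsub>A\<^esub> x)"
    using f by (auto simp: module_mono_def module_hom_def)
  show ?thesis
    by (auto simp: module_hom_def inv_into_f_f[OF inj] add smult)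
qed

lemma carrier_subset_if_mono_into_stable:
  assumes E: "left_module R E" and sub: "carrier M \<subseteq> carrier E"
    and stable: "stable_under_partial_endomorphisms R M E"
    and f: "f \<in> module_mono R E (E\<lparr>carrier := carrier M\<rparr>)"
  shows "carrier E \<subseteq> carrier M"
proof -
  let ?M1 = "f ` carrier E"
  let ?h = "inv_into (carrier E) f"
  have into: "?M1 \<subseteq> carrier M" and inj: "inj_on f (carrier E)"
    using f by (auto simp: module_mono_def module_hom_def)
  \<comment> \<open>Only the codomain grows: the submodule record carries the operations of
    \<open>E\<close>.\<close>
  have f': "f \<in> module_mono R E E"
    using f sub by (auto simp: module_mono_def module_hom_def)
  have "submodule ?M1 R E"
    using submodule_image[OF E E] f' by (simp add: module_mono_def)
  then have "?h ` (carrier M \<inter> ?M1) \<subseteq> carrier M"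
    using stable inv_into_module_hom[OF E f'] unfolding stable_under_partial_endomorphisms_def
    by blast
  then show ?thesis
    \<comment> \<open>The image of \<open>f\<close> lies in \<open>M\<close>, so the intersection is
      the whole image, and \<open>?h\<close> maps it onto \<open>E\<close>.\<close>
    using into inj by (simp add: Int_absorb1 inv_into_image_cancel)
qed

theorem corollary2p8:
  fixes R :: "('r, 'x) ring_scheme" and M E :: "('r, 'm) module"
  assumes "ring R" and "\<one>\<^bsub>R\<^esub> \<noteq> \<zero>\<^bsub>R\<^esub>"
    and "left_module R M"
    and "injective_hull R M E"
    and "compressible R M" and "compressible R E"
    and "nonsingular R M"
    and "stable_under_partial_endomorphisms R M E"
  shows "critically_compressible R E \<longleftrightarrow> critically_compressible R M"
proof -
  have E: "left_module R E" and sub: "submodule (carrier M) R E"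
    and add: "\<And>x y. \<lbrakk>x \<in> carrier M; y \<in> carrier M\<rbrakk> \<Longrightarrow> x \<oplus>\<^bsub>M\<^esub> y = x \<oplus>\<^bsub>E\<^esub> y"
    and smult: "\<And>r x. \<lbrakk>r \<in> carrier R; x \<in> carrier M\<rbrakk> \<Longrightarrow> r \<odot>\<^bsub>M\<^esub> x = r \<odot>\<^bsub>E\<^esub> x"
    using assms(4)
    by (auto simp: injective_hull_def injective_module_def essential_submodule_def)
  interpret M: left_module R M by fact
  interpret E: left_module R E by fact
  have subset: "carrier M \<subseteq> carrier E"
    using sub by (simp add: submodule_def subgroup_def)
  \<comment> \<open>Compressibility of \<open>M\<close> rules out its own zero module, whereas that
    of \<open>E\<close> needs a submodule that is nonzero in terms of the zero of
    \<open>E\<close>.\<close>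
  have "\<zero>\<^bsub>M\<^esub> = \<zero>\<^bsub>E\<^esub>"
    by (metis E.M.add.r_cancel_one M.M.l_zero M.M.zero_closed add subset subsetD)
  then have "carrier M \<noteq> {\<zero>\<^bsub>E\<^esub>}"
    using assms(5) by (simp add: compressible_def)
  then obtain f where "f \<in> module_mono R E (E\<lparr>carrier := carrier M\<rparr>)"
    using assms(6) sub unfolding compressible_def by blast
  then have "carrier M = carrier E"
    using carrier_subset_if_mono_into_stable[OF E subset assms(8)] subset by blast
  then interpret agreeing_modules R M E
    by unfold_locales (simp_all add: add smult)
  show ?thesis
    using critically_compressible_iff by simp
qed

end
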